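(* Let $b_n$ denote the number of bent functions on $n$ variables. Then, as $n\to\infty$ over even integers, $$\log_2 b_n \geq \frac{3n}{4}\cdot 2^{n/2} - 2\log_2 e\cdot 2^{n/2} + o(2^{n/2}).$$
   Context: A Boolean function on $n$ variables is a map $f:F_2^n\to F_2$, where $F_2=\{0,1\}$. For $x,u\in F_2^n$, $\langle u,x\rangle=u_1x_1\oplus\cdots\oplus u_nx_n$. The Walsh transform of $f$ is $W_f(u)=\sum_{x\in F_2^n}(-1)^{\langle u,x\rangle\oplus f(x)}$ for $u\in F_2^n$. A Boolean function $f$ on $n$ variables is a bent function if $|W_f(u)|=2^{n/2}$ for all $u\in F_2^n$. *)

theory Defs
  imports "HOL-Analysis.Analysis" "HOL-Library.Landau_Symbols" "HOL-Library.Z2"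
begin

text \<open>
  The field with two elements is the type \<^typ>\<open>bit\<close>. Since the number of variables has to
  vary within one statement, vectors of length \<open>n\<close> are functions on \<open>{..<n}\<close> (coordinates
  \<open>0, \<dots>, n - 1\<close>), and vectors and Boolean functions are taken to be \<^const>\<open>undefined\<close>
  outside their domain, so that each of them is represented exactly once and counting is meaningful.
\<close>

definition F2_space :: "nat \<Rightarrow> (nat \<Rightarrow> bit) set" where
  "F2_space n = ({..<n} \<rightarrow>\<^sub>E UNIV)"

definition boolean_functions :: "nat \<Rightarrow> ((nat \<Rightarrow> bit) \<Rightarrow> bit) set" where
  "boolean_functions n = (F2_space n \<rightarrow>\<^sub>E UNIV)"

definition F2_inner :: "nat \<Rightarrow> (nat \<Rightarrow> bit) \<Rightarrow> (nat \<Rightarrow> bit) \<Rightarrow> bit" where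
  "F2_inner n u x = (\<Sum>i<n. u i * x i)"

definition walsh :: "nat \<Rightarrow> ((nat \<Rightarrow> bit) \<Rightarrow> bit) \<Rightarrow> (nat \<Rightarrow> bit) \<Rightarrow> int" where
  "walsh n f u = (\<Sum>x\<in>F2_space n. (-1) ^ (of_bit (F2_inner n u x + f x) :: nat))"

definition bent :: "nat \<Rightarrow> ((nat \<Rightarrow> bit) \<Rightarrow> bit) \<Rightarrow> bool" where
  "bent n f \<longleftrightarrow> f \<in> boolean_functions n \<and>
     (\<forall>u\<in>F2_space n. \<bar>real_of_int (walsh n f u)\<bar> = 2 powr (real n / 2))"

definition num_bent :: "nat \<Rightarrow> nat" where
  "num_bent n = card {f. bent n f}"

definition even_at_top :: "nat filter" where
  "even_at_top = inf at_top (principal {n. even n})"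

end

theory Submission
  imports Defs "HOL-Combinatorics.Permutations"
begin

text \<open>
  Write \<open>n = 2 k + 2\<close> and \<open>M = 2 ^ k\<close>. A concatenation, indexed by \<open>x\<close> in \<open>F\<^sub>2\<^sup>k\<close>, of
  functions of \<open>k + 2\<close> variables whose Walsh spectra are flat on affine planes that partition
  \<open>F\<^sub>2\<^bsup>k+2\<^esup>\<close> is bent. Planes with one point over each element of \<open>F\<^sub>2\<^sup>2\<close> come from permutations
  \<open>p, q, r, s\<close> of \<open>F\<^sub>2\<^sup>k\<close> with \<open>p + q + r + s = 0\<close>, and each plane supports \<open>8\<close> such functions.
  In characteristic two the quadruples are the collisions \<open>p + q = r + s\<close>, so by the
  Cauchy-Schwarz inequality there are at least \<open>(M!)\<^sup>4 / M ^ M\<close> of them, and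
  \<open>M! \<ge> (M / e) ^ M\<close> gives the bound, without an error term.
\<close>

text \<open>Keeps \<open>+\<close> and \<open>*\<close> on bits as field operations, so that ring
  laws apply to them.\<close>

declare add_bit_eq_xor [simp del] mult_bit_eq_and [simp del]

section \<open>Characters of the Boolean hypercube\<close>

definition bit_sign :: "bit \<Rightarrow> int" where
  "bit_sign b = (-1) ^ (of_bit b :: nat)"

lemma bit_sign_simps [simp]: "bit_sign 0 = 1" "bit_sign 1 = -1"
  by (simp_all add: bit_sign_def)

lemma bit_sign_add: "bit_sign (a + b) = bit_sign a * bit_sign b"
  by (cases a; cases b) simp_all

lemma bit_sign_mult_self [simp]: "bit_sign a * bit_sign a = 1"
  by (cases a) simp_all

lemma abs_bit_sign [simp]: "\<bar>bit_sign a\<bar> = 1"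
  by (cases a) simp_all

lemma bit_add_self [simp]: "b + b = (0::bit)"
  by (cases b) simp_all

lemma bit_add_self_left [simp]: "b + (b + c) = (c::bit)"
  by (cases b; cases c) simp_all

lemma UNIV_bit_eq: "(UNIV :: bit set) = {0, 1}"
  using bit.exhaust by auto

lemma finite_UNIV_bit [simp]: "finite (UNIV :: bit set)"
  by (simp add: UNIV_bit_eq)

lemma card_UNIV_bit [simp]: "card (UNIV :: bit set) = 2"
  by (simp add: UNIV_bit_eq)

lemma finite_F2_space [simp]: "finite (F2_space n)"
  unfolding F2_space_def by (intro finite_PiE) auto

lemma card_F2_space: "card (F2_space n) = 2 ^ n"
  unfolding F2_space_def by (simp add: card_PiE)

lemma F2_space_eqI:
  "u \<in> F2_space n \<Longrightarrow> v \<in> F2_space n \<Longrightarrow> (\<And>i. i < n \<Longrightarrow> u i = v i) \<Longrightarrow> u = v"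
  unfolding F2_space_def by (rule PiE_ext) auto

lemma F2_inner_flip:
  assumes "i < n"
  shows "F2_inner n u (y(i := y i + 1)) = F2_inner n u y + u i"
proof -
  have "F2_inner n u (y(i := y i + 1)) = (\<Sum>j<n. u j * y j + (if j = i then u i else 0))"
    unfolding F2_inner_def by (rule sum.cong) (auto simp: algebra_simps)
  then show ?thesis
    using assms by (simp add: sum.distrib F2_inner_def)
qed

text \<open>If \<open>u\<close> and \<open>v\<close> differ at \<open>i\<close>, flipping coordinate
  \<open>i\<close> of \<open>y\<close> is an involution that negates every term, so the sum is its
  own negative. If \<open>u = v\<close>, every term is 1.\<close>

lemma F2_character_orthogonality:
  assumes u: "u \<in> F2_space n" and v: "v \<in> F2_space n"
  shows "(\<Sum>y\<in>F2_space n. bit_sign (F2_inner n u y) * bit_sign (F2_inner n v y)) =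
    (if u = v then 2 ^ n else 0)"
proof (cases "u = v")
  case True
  then show ?thesis
    by (simp add: card_F2_space)
next
  case False
  then obtain i where i: "i < n" "u i \<noteq> v i"
    using F2_space_eqI[OF u v] by blast
  let ?g = "\<lambda>y. bit_sign (F2_inner n u y) * bit_sign (F2_inner n v y)"
  let ?h = "\<lambda>y. y(i := y i + (1::bit))"
  have flip: "?g (?h y) = - ?g y" for y
    using i(2) by (cases "u i"; cases "v i") (simp_all add: F2_inner_flip[OF i(1)] bit_sign_add)
  have mem: "?h y \<in> F2_space n" if "y \<in> F2_space n" for y
    using that i(1) by (auto simp: F2_space_def PiE_iff extensional_def)
  have "sum ?g (F2_space n) = (\<Sum>y\<in>F2_space n. ?g (?h y))"
    by (rule sum.reindex_bij_witness[of _ ?h ?h]) (auto simp: mem add.assoc)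
  also have "\<dots> = - sum ?g (F2_space n)"
    by (simp add: flip sum_negf)
  finally show ?thesis
    using False by simp
qed

text \<open>Evaluating at the zero vector isolates the constants, and then the unit vectors isolate
  the coordinates.\<close>

lemma F2_inner_separates:
  assumes u: "u \<in> F2_space n" and v: "v \<in> F2_space n"
    and eq: "\<And>y. y \<in> F2_space n \<Longrightarrow> a + F2_inner n u y = b + F2_inner n v y"
  shows "a = b" and "u = v"
proof -
  define z :: "nat \<Rightarrow> bit" where "z = (\<lambda>i\<in>{..<n}. 0)"
  have z: "z \<in> F2_space n"
    by (simp add: z_def F2_space_def)
  have inner_z: "F2_inner n w z = 0" for w
    by (simp add: z_def F2_inner_def)
  show "a = b"
    using eq[OF z] by (simp add: inner_z)
  show "u = v"
  proof (rule F2_space_eqI[OF u v])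
    fix i assume i: "i < n"
    have "z(i := z i + 1) \<in> F2_space n"
      using z i by (auto simp: F2_space_def PiE_iff extensional_def)
    from eq[OF this] show "u i = v i"
      using \<open>a = b\<close> by (simp add: F2_inner_flip[OF i] inner_z)
  qed
qed

section \<open>Coordinate blocks\<close>

text \<open>The block \<open>x\<close> indexes the concatenated pieces; \<open>(y, d, e)\<close> are
  the \<open>k + 2\<close> variables of each piece.\<close>

definition join_blocks ::
    "nat \<Rightarrow> (nat \<Rightarrow> bit) \<times> (nat \<Rightarrow> bit) \<times> bit \<times> bit \<Rightarrow> nat \<Rightarrow> bit" where
  "join_blocks k = (\<lambda>(x, y, d, e). \<lambda>i\<in>{..<2 * k + 2}.
     if i < k then x i else if i < 2 * k then y (i - k) else if i = 2 * k then d else e)"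

definition split_blocks ::
    "nat \<Rightarrow> (nat \<Rightarrow> bit) \<Rightarrow> (nat \<Rightarrow> bit) \<times> (nat \<Rightarrow> bit) \<times> bit \<times> bit" where
  "split_blocks k z = (\<lambda>i\<in>{..<k}. z i, \<lambda>i\<in>{..<k}. z (k + i), z (2 * k), z (2 * k + 1))"

abbreviation blocks where
  "blocks k \<equiv> F2_space k \<times> F2_space k \<times> (UNIV :: bit set) \<times> (UNIV :: bit set)"

lemma join_blocks_mem: "join_blocks k w \<in> F2_space (2 * k + 2)"
  by (cases w) (simp add: join_blocks_def F2_space_def)

lemma split_blocks_mem: "split_blocks k z \<in> blocks k"
  by (simp add: split_blocks_def F2_space_def)

lemma split_join_blocks:
  assumes "w \<in> blocks k"
  shows "split_blocks k (join_blocks k w) = w"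
  using assms
  by (cases w)
    (auto simp: split_blocks_def join_blocks_def F2_space_def PiE_iff extensional_def
      restrict_def fun_eq_iff)

lemma join_split_blocks:
  assumes "z \<in> F2_space (2 * k + 2)"
  shows "join_blocks k (split_blocks k z) = z"
proof (rule F2_space_eqI[OF join_blocks_mem assms])
  fix i assume i: "i < 2 * k + 2"
  then consider "i < k" | "k \<le> i" "i < 2 * k" | "i = 2 * k" | "i = 2 * k + 1"
    by linarith
  then show "join_blocks k (split_blocks k z) i = z i"
    using i by cases (auto simp: split_blocks_def join_blocks_def)
qed

lemma F2_inner_join_blocks:
  "F2_inner (2 * k + 2) (join_blocks k (u, v, a, b)) (join_blocks k (x, y, d, e)) =
     F2_inner k u x + F2_inner k v y + a * d + b * e"
proof -
  have split: "(\<Sum>i<2 * k + 2. g i) = (\<Sum>i<k. g i) + (\<Sum>i<k. g (k + i)) + g (2 * k) + g (2 * k + 1)"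
    for g :: "nat \<Rightarrow> bit"
  proof -
    have "(\<Sum>i<k + k. g i) = (\<Sum>i<k. g i) + (\<Sum>i<k. g (k + i))"
      using sum.atLeastLessThan_concat[of 0 k "k + k" g] sum.shift_bounds_nat_ivl[of g 0 k k]
      by (simp add: lessThan_atLeast0 add.commute)
    then show ?thesis
      by (simp add: mult_2)
  qed
  show ?thesis
    unfolding F2_inner_def split by (simp add: join_blocks_def)
qed

lemma sum_F2_space_blocks:
  "(\<Sum>z\<in>F2_space (2 * k + 2). g z) =
     (\<Sum>x\<in>F2_space k. \<Sum>y\<in>F2_space k. \<Sum>d\<in>UNIV. \<Sum>e\<in>UNIV. g (join_blocks k (x, y, d, e)))"
proof -
  have "(\<Sum>z\<in>F2_space (2 * k + 2). g z) = (\<Sum>w\<in>blocks k. g (join_blocks k w))"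
    by (rule sum.reindex_bij_witness[of _ "join_blocks k" "split_blocks k"])
      (simp_all only: split_join_blocks join_split_blocks join_blocks_mem split_blocks_mem)
  then show ?thesis
    by (simp add: sum.cartesian_product case_prod_unfold)
qed

section \<open>The bent functions of a zero-sum quadruple of permutations\<close>

definition F2_add :: "nat \<Rightarrow> (nat \<Rightarrow> bit) \<Rightarrow> (nat \<Rightarrow> bit) \<Rightarrow> nat \<Rightarrow> bit" where
  "F2_add n u v = (\<lambda>i\<in>{..<n}. u i + v i)"

lemma F2_add_mem: "F2_add n u v \<in> F2_space n"
  by (simp add: F2_add_def F2_space_def)

lemma F2_inner_add: "F2_inner n (F2_add n u v) y = F2_inner n u y + F2_inner n v y"
  by (simp add: F2_inner_def F2_add_def distrib_right sum.distrib)

definition bit_majority :: "bit \<Rightarrow> bit \<Rightarrow> bit \<Rightarrow> bit" where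
  "bit_majority a b c = a * b + a * c + b * c"

text \<open>For fixed \<open>a, b, c\<close> the summed majority is a bent function of
  \<open>(d, e)\<close>, so all four Walsh values are 2 up to sign. Three signs are free and the
  product of all four is -1, which is why each plane carries 8 functions.\<close>

lemma bit_majority_walsh:
  "(\<Sum>d\<in>UNIV. \<Sum>e\<in>UNIV. bit_sign (i * d + j * e + bit_majority a (b + d) (c + e))) =
     2 * bit_sign (if i = 0 then if j = 0 then a else c else if j = 0 then b else 1 + a + b + c)"
  by (cases i; cases j; cases a; cases b; cases c) (simp_all add: UNIV_bit_eq bit_majority_def)

text \<open>As a polynomial in \<open>d, e\<close> the majority has linear coefficients
  \<open>a + c\<close> and \<open>a + b\<close>. These fix \<open>a, b, c\<close> up to a common
  complement, and complementing all three flips the constant term.\<close>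

lemma bit_majority_separates:
  assumes "\<And>d e. bit_majority a (b + d) (c + e) = bit_majority a' (b' + d) (c' + e)"
  shows "a = a'" and "b = b'" and "c = c'"
  using assms[of 0 0] assms[of 0 1] assms[of 1 0] assms[of 1 1]
  by (cases a; cases b; cases c; cases a'; cases b'; cases c'; simp add: bit_majority_def)+

text \<open>For fixed \<open>x\<close>, the majority of three affine functions of
  \<open>(y, d, e)\<close> with frequencies \<open>(p x, 0, 0)\<close>, \<open>(q x, 1, 0)\<close>,
  \<open>(r x, 0, 1)\<close>. The fourth frequency in its spectrum is their sum, over
  \<open>(1, 1)\<close>.\<close>

definition majority_concat where
  "majority_concat k p q r a b c = (\<lambda>z\<in>F2_space (2 * k + 2).
     case split_blocks k z of (x, y, d, e) \<Rightarrow>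
       bit_majority (a x + F2_inner k (p x) y) (b x + F2_inner k (q x) y + d)
         (c x + F2_inner k (r x) y + e))"

lemma majority_concat_join:
  assumes "x \<in> F2_space k" and "y \<in> F2_space k"
  shows "majority_concat k p q r a b c (join_blocks k (x, y, d, e)) =
    bit_majority (a x + F2_inner k (p x) y) (b x + F2_inner k (q x) y + d)
      (c x + F2_inner k (r x) y + e)"
  using assms join_blocks_mem[of k "(x, y, d, e)"] split_join_blocks[of "(x, y, d, e)" k]
  by (simp add: majority_concat_def)

text \<open>
  For fixed \<open>x\<close>, the Walsh spectrum in \<open>(y, d, e)\<close> is supported on the affine plane
  \<open>{(p x, 0, 0), (q x, 1, 0), (r x, 0, 1), (s x, 1, 1)}\<close>, and these planes partition the space.
\<close>
lemma bent_majority_concat: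
  assumes perm: "p permutes F2_space k" "q permutes F2_space k"
      "r permutes F2_space k" "s permutes F2_space k"
    and zero_sum: "\<And>x. x \<in> F2_space k \<Longrightarrow> F2_add k (p x) (q x) = F2_add k (r x) (s x)"
  shows "bent (2 * k + 2) (majority_concat k p q r a b c)"
  unfolding bent_def
proof (intro conjI ballI)
  let ?V = "F2_space k" and ?f = "majority_concat k p q r a b c"
  show "?f \<in> boolean_functions (2 * k + 2)"
    by (simp add: boolean_functions_def majority_concat_def)
  fix w assume w: "w \<in> F2_space (2 * k + 2)"
  obtain u v i j where split: "split_blocks k w = (u, v, i, j)"
    by (cases "split_blocks k w")
  have w_eq: "w = join_blocks k (u, v, i, j)"
    using join_split_blocks[OF w] split by simp
  have v: "v \<in> ?V"
    using split_blocks_mem[of k w] split by simp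
  \<comment> \<open>The last two coordinates \<open>(i, j)\<close> of the frequency select one point
    of each plane: \<open>g x\<close> is its first component and \<open>h x\<close> the exponent of
    its sign.\<close>
  define g where "g = (if i = 0 then if j = 0 then p else r else if j = 0 then q else s)"
  define h where "h x = (if i = 0 then if j = 0 then a x else c x else if j = 0 then b x
    else 1 + a x + b x + c x)" for x
  have g: "g permutes ?V"
    using perm by (simp add: g_def)
  have s_inner: "F2_inner k (s x) y = F2_inner k (p x) y + F2_inner k (q x) y + F2_inner k (r x) y"
    if "x \<in> ?V" for x y
  proof -
    have "F2_inner k (p x) y + F2_inner k (q x) y = F2_inner k (r x) y + F2_inner k (s x) y"
      using arg_cong[OF zero_sum[OF that], of "\<lambda>u. F2_inner k u y"] by (simp add: F2_inner_add)
    then show ?thesis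
      by (simp add: ac_simps)
  qed
  have selected: "(if i = 0 then if j = 0 then a x + F2_inner k (p x) y else c x + F2_inner k (r x) y
      else if j = 0 then b x + F2_inner k (q x) y
      else 1 + (a x + F2_inner k (p x) y) + (b x + F2_inner k (q x) y) + (c x + F2_inner k (r x) y))
      = h x + F2_inner k (g x) y" if "x \<in> ?V" for x y
    using s_inner[OF that, of y] by (simp add: g_def h_def ac_simps)
  \<comment> \<open>Since \<open>g\<close> is a bijection, exactly one plane contains
    \<open>(v, i, j)\<close>, so a single \<open>x\<close> contributes to the Walsh sum.\<close>
  obtain x0 where x0: "x0 \<in> ?V" "g x0 = v"
    using g v by (metis permutes_image imageE)
  have g_eq: "v = g x \<longleftrightarrow> x = x0" for x
    using x0 permutes_inj[OF g] by (auto dest: injD)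
  have inner_sum: "(\<Sum>d\<in>UNIV. \<Sum>e\<in>UNIV. bit_sign (F2_inner (2 * k + 2) w (join_blocks k (x, y, d, e))
        + ?f (join_blocks k (x, y, d, e))))
      = 2 * bit_sign (F2_inner k u x + h x) * (bit_sign (F2_inner k v y) * bit_sign (F2_inner k (g x) y))"
    if "x \<in> ?V" "y \<in> ?V" for x y
  proof -
    \<comment> \<open>Summing out \<open>d, e\<close> first turns the majority into the sign of one
      affine function of \<open>y\<close>; the remaining sum over \<open>y\<close> is then an
      orthogonality relation.\<close>
    have "(\<Sum>d\<in>UNIV. \<Sum>e\<in>UNIV. bit_sign (F2_inner (2 * k + 2) w (join_blocks k (x, y, d, e))
        + ?f (join_blocks k (x, y, d, e))))
      = bit_sign (F2_inner k u x + F2_inner k v y) * (\<Sum>d\<in>UNIV. \<Sum>e\<in>UNIV. bit_sign (i * d + j * e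
          + bit_majority (a x + F2_inner k (p x) y) (b x + F2_inner k (q x) y + d)
              (c x + F2_inner k (r x) y + e)))"
      unfolding w_eq F2_inner_join_blocks majority_concat_join[OF that]
      by (simp add: sum_distrib_left bit_sign_add mult.assoc)
    also have "\<dots> = bit_sign (F2_inner k u x + F2_inner k v y) *
        (2 * bit_sign (h x + F2_inner k (g x) y))"
      unfolding bit_majority_walsh selected[OF that(1)] ..
    finally show ?thesis
      by (simp add: bit_sign_add)
  qed
  have "walsh (2 * k + 2) ?f w = (\<Sum>x\<in>?V. \<Sum>y\<in>?V. 2 * bit_sign (F2_inner k u x + h x) *
      (bit_sign (F2_inner k v y) * bit_sign (F2_inner k (g x) y)))"
    unfolding walsh_def bit_sign_def[symmetric] sum_F2_space_blocks
    by (intro sum.cong refl inner_sum)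
  also have "\<dots> = (\<Sum>x\<in>?V. 2 * bit_sign (F2_inner k u x + h x) * (if x = x0 then 2 ^ k else 0))"
  proof (rule sum.cong[OF refl])
    fix x assume "x \<in> ?V"
    then have "g x \<in> ?V"
      using g by (simp add: permutes_in_image)
    then show "(\<Sum>y\<in>?V. 2 * bit_sign (F2_inner k u x + h x) *
        (bit_sign (F2_inner k v y) * bit_sign (F2_inner k (g x) y)))
      = 2 * bit_sign (F2_inner k u x + h x) * (if x = x0 then 2 ^ k else 0)"
      by (simp only: sum_distrib_left[symmetric] F2_character_orthogonality[OF v] g_eq)
  qed
  also have "\<dots> = 2 * bit_sign (F2_inner k u x0 + h x0) * 2 ^ k"
    using x0(1) by (simp add: if_distrib cong: if_cong)
  finally have "\<bar>walsh (2 * k + 2) ?f w\<bar> = 2 ^ (k + 1)"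
    by (simp add: abs_mult)
  then have "\<bar>real_of_int (walsh (2 * k + 2) ?f w)\<bar> = 2 ^ (k + 1)"
    by (metis of_int_abs of_int_numeral of_int_power)
  also have "\<dots> = 2 powr (real (2 * k + 2) / 2)"
    by (simp add: powr_realpow[symmetric] add_divide_distrib powr_add)
  finally show "\<bar>real_of_int (walsh (2 * k + 2) ?f w)\<bar> = 2 powr (real (2 * k + 2) / 2)" .
qed

text \<open>Varying \<open>d, e\<close> recovers the values of the three affine functions at each
  \<open>y\<close>; varying \<open>y\<close> then recovers their constants and linear parts.\<close>

lemma majority_concat_separates:
  assumes eq: "majority_concat k p q r a b c = majority_concat k p' q' r' a' b' c'"
    and perm: "p permutes F2_space k" "q permutes F2_space k" "r permutes F2_space k"
      "p' permutes F2_space k" "q' permutes F2_space k" "r' permutes F2_space k"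
    and x: "x \<in> F2_space k"
  shows "p x = p' x" "q x = q' x" "r x = r' x" "a x = a' x" "b x = b' x" "c x = c' x"
proof -
  have eq': "bit_majority (a x + F2_inner k (p x) y) (b x + F2_inner k (q x) y + d)
      (c x + F2_inner k (r x) y + e) =
    bit_majority (a' x + F2_inner k (p' x) y) (b' x + F2_inner k (q' x) y + d)
      (c' x + F2_inner k (r' x) y + e)" if "y \<in> F2_space k" for y d e
    using arg_cong[OF eq, of "\<lambda>f. f (join_blocks k (x, y, d, e))"] x that
    by (simp add: majority_concat_join)
  note sep = bit_majority_separates[OF eq']
  have mem: "p x \<in> F2_space k" "q x \<in> F2_space k" "r x \<in> F2_space k"
    "p' x \<in> F2_space k" "q' x \<in> F2_space k" "r' x \<in> F2_space k"
    using perm x by (simp_all add: permutes_in_image)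
  show "a x = a' x" "p x = p' x"
    using F2_inner_separates[OF mem(1,4) sep(1)] by blast+
  show "b x = b' x" "q x = q' x"
    using F2_inner_separates[OF mem(2,5) sep(2)] by blast+
  show "c x = c' x" "r x = r' x"
    using F2_inner_separates[OF mem(3,6) sep(3)] by blast+
qed

section \<open>Counting zero-sum quadruples\<close>

text \<open>Cauchy-Schwarz for fibre sizes: they sum to \<open>card A\<close>, and their squares sum
  to the number of collisions.\<close>

lemma card_square_le_card_collisions:
  assumes A: "finite A" and B: "finite B" and f: "f ` A \<subseteq> B"
  shows "(card A)\<^sup>2 \<le> card B * card {(x, y). x \<in> A \<and> y \<in> A \<and> f x = f y}" (is "_ \<le> _ * card ?C")
proof -
  define fib where "fib b = {x \<in> A. f x = b}" for b
  have "?C \<subseteq> A \<times> A"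
    by auto
  then have C: "finite ?C" "(f \<circ> fst) ` ?C \<subseteq> B"
    using A f by (auto dest: finite_subset)
  have pairs: "{z \<in> ?C. (f \<circ> fst) z = b} = fib b \<times> fib b" for b
    by (auto simp: fib_def)
  have card_A: "card A = (\<Sum>b\<in>B. card (fib b))"
    using sum.group[OF A B f, of "\<lambda>_. 1 :: nat"] by (simp add: fib_def)
  have card_C: "card ?C = (\<Sum>b\<in>B. (card (fib b))\<^sup>2)"
    using sum.group[OF C(1) B C(2), of "\<lambda>_. 1 :: nat"]
    unfolding pairs by (simp add: card_cartesian_product power2_eq_square)
  have "real ((card A)\<^sup>2) = (\<Sum>b\<in>B. real (card (fib b)))\<^sup>2"
    by (simp only: card_A of_nat_power of_nat_sum)
  also have "\<dots> \<le> (\<Sum>b\<in>B. (real (card (fib b)))\<^sup>2) * card B"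
    by (rule sum_squared_le_sum_of_squares)
  also have "\<dots> = real (card B * card ?C)"
    by (simp only: card_C of_nat_power of_nat_sum of_nat_mult mult.commute)
  finally show ?thesis
    by (simp only: of_nat_le_iff)
qed

text \<open>The nesting into two pairs makes this literally the collision set of
  \<open>(p, q) \<mapsto> p + q\<close>; in characteristic two a collision is a zero sum.\<close>

definition zero_sum_quadruples where
  "zero_sum_quadruples k = {((p, q), (r, s)).
     p permutes F2_space k \<and> q permutes F2_space k \<and> r permutes F2_space k \<and> s permutes F2_space k \<and>
     (\<forall>x\<in>F2_space k. F2_add k (p x) (q x) = F2_add k (r x) (s x))}"

text \<open>With \<open>M = 2 ^ k\<close>, there are \<open>(M!)^2\<close> pairs of permutations,
  and their pointwise sums lie among the \<open>M ^ M\<close> self-maps of the space. The collision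
  bound applies.\<close>

lemma card_zero_sum_quadruples_ge:
  "fact (2 ^ k) ^ 4 \<le> (2 ^ k) ^ (2 ^ k) * card (zero_sum_quadruples k)"
proof -
  let ?P = "{p. p permutes F2_space k}"
  let ?sum = "\<lambda>(p, q). \<lambda>x\<in>F2_space k. F2_add k (p x) (q x)"
  have finite_P: "finite ?P" and card_P: "card ?P = fact (2 ^ k)"
    by (simp_all add: finite_permutations card_permutations card_F2_space)
  have sum_eq: "(\<lambda>x\<in>F2_space k. g x) = (\<lambda>x\<in>F2_space k. h x) \<longleftrightarrow> (\<forall>x\<in>F2_space k. g x = h x)"
    for g h :: "(nat \<Rightarrow> bit) \<Rightarrow> nat \<Rightarrow> bit"
    by (metis restrict_apply restrict_ext)
  have "(card (?P \<times> ?P))\<^sup>2 \<le> card (F2_space k \<rightarrow>\<^sub>E F2_space k) *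
      card {(v, w). v \<in> ?P \<times> ?P \<and> w \<in> ?P \<times> ?P \<and> ?sum v = ?sum w}"
    by (rule card_square_le_card_collisions)
      (simp_all add: finite_P finite_PiE image_subset_iff case_prod_unfold F2_add_mem)
  also have "{(v, w). v \<in> ?P \<times> ?P \<and> w \<in> ?P \<times> ?P \<and> ?sum v = ?sum w} = zero_sum_quadruples k"
    unfolding zero_sum_quadruples_def
    by (simp add: set_eq_iff case_prod_unfold sum_eq mem_Times_iff conj_assoc)
  also have "card (F2_space k \<rightarrow>\<^sub>E F2_space k) = (2 ^ k) ^ (2 ^ k)"
    by (simp add: card_funcsetE card_F2_space)
  finally show ?thesis
    by (simp only: card_cartesian_product card_P power2_eq_square power4_eq_xxxx mult.assoc)
qed

section \<open>From zero-sum quadruples to bent functions\<close>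

text \<open>A quadruple and three sign functions \<open>a, b, c\<close> on \<open>F2_space k\<close>
  determine a bent function injectively; the sign functions supply the \<open>3 * 2 ^ k\<close> free
  bits.\<close>

lemma num_bent_ge_zero_sum_quadruples:
  "card (zero_sum_quadruples k) * 2 ^ (3 * 2 ^ k) \<le> num_bent (2 * k + 2)"
proof -
  let ?V = "F2_space k"
  let ?S = "boolean_functions k"
  let ?D = "zero_sum_quadruples k \<times> ?S \<times> ?S \<times> ?S"
  let ?F = "\<lambda>(((p, q), (r, s)), a, b, c). majority_concat k p q r a b c"
  \<comment> \<open>Finiteness is essential here: \<open>card\<close> of an infinite set would be
    0.\<close>
  have finite_bent: "finite {f. bent (2 * k + 2) f}"
  proof (rule finite_subset)
    show "{f. bent (2 * k + 2) f} \<subseteq> boolean_functions (2 * k + 2)"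
      by (auto simp: bent_def)
    show "finite (boolean_functions (2 * k + 2))"
      unfolding boolean_functions_def by (intro finite_PiE) simp_all
  qed
  have "inj_on ?F ?D"
  proof (rule inj_onI)
    fix v w assume vw: "v \<in> ?D" "w \<in> ?D" "?F v = ?F w"
    obtain p q r s a b c where v: "v = (((p, q), (r, s)), a, b, c)"
      by (metis prod.exhaust)
    obtain p' q' r' s' a' b' c' where w: "w = (((p', q'), (r', s')), a', b', c')"
      by (metis prod.exhaust)
    have perm: "p permutes ?V" "q permutes ?V" "r permutes ?V" "s permutes ?V"
        "p' permutes ?V" "q' permutes ?V" "r' permutes ?V" "s' permutes ?V"
      and zero_sum: "\<And>x. x \<in> ?V \<Longrightarrow> F2_add k (p x) (q x) = F2_add k (r x) (s x)"
        "\<And>x. x \<in> ?V \<Longrightarrow> F2_add k (p' x) (q' x) = F2_add k (r' x) (s' x)"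
      and S: "a \<in> ?S" "b \<in> ?S" "c \<in> ?S" "a' \<in> ?S" "b' \<in> ?S" "c' \<in> ?S"
      using vw(1,2) unfolding v w zero_sum_quadruples_def by auto
    have "majority_concat k p q r a b c = majority_concat k p' q' r' a' b' c'"
      using vw(3) by (simp add: v w)
    note sep = majority_concat_separates[OF this perm(1-3,5-7)]
    \<comment> \<open>Agreement on the space suffices: permutations fix every point outside it, and
      Boolean functions are \<open>undefined\<close> there.\<close>
    have perm_eqI: "g = h" if "g permutes ?V" "h permutes ?V" "\<And>x. x \<in> ?V \<Longrightarrow> g x = h x" for g h
      using that by (metis ext permutes_not_in)
    have S_eqI: "g = h" if "g \<in> ?S" "h \<in> ?S" "\<And>x. x \<in> ?V \<Longrightarrow> g x = h x" for g h
      using that unfolding boolean_functions_def by (rule PiE_ext)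
    \<comment> \<open>The concatenation reveals only \<open>p, q, r\<close>; \<open>s\<close>
      follows by cancelling \<open>r x\<close> in the zero-sum relation.\<close>
    have "s x = s' x" if x: "x \<in> ?V" for x
    proof (rule F2_space_eqI)
      show "s x \<in> ?V" "s' x \<in> ?V"
        using perm(4,8) x by (simp_all add: permutes_in_image)
      fix i assume "i < k"
      have "F2_add k (r x) (s x) = F2_add k (r x) (s' x)"
        using zero_sum(1)[OF x] unfolding sep(1-3)[OF x] zero_sum(2)[OF x] by (rule sym)
      from fun_cong[OF this, of i] have "r x i + s x i = r x i + s' x i"
        using \<open>i < k\<close> by (simp only: F2_add_def restrict_apply lessThan_iff if_True)
      then show "s x i = s' x i"
        by (metis bit_add_self_left)
    qed
    then have "s = s'"
      by (rule perm_eqI[OF perm(4,8)])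
    moreover have "p = p'" "q = q'" "r = r'"
      by (rule perm_eqI[OF perm(1,5) sep(1)] perm_eqI[OF perm(2,6) sep(2)]
          perm_eqI[OF perm(3,7) sep(3)]; assumption)+
    moreover have "a = a'" "b = b'" "c = c'"
      by (rule S_eqI[OF S(1,4) sep(4)] S_eqI[OF S(2,5) sep(5)] S_eqI[OF S(3,6) sep(6)]; assumption)+
    ultimately show "v = w"
      by (simp add: v w)
  qed
  moreover have "?F ` ?D \<subseteq> {f. bent (2 * k + 2) f}"
  proof (rule image_subsetI)
    fix v assume v: "v \<in> ?D"
    obtain p q r s a b c where v_eq: "v = (((p, q), (r, s)), a, b, c)"
      by (metis prod.exhaust)
    have "bent (2 * k + 2) (majority_concat k p q r a b c)"
      using v unfolding v_eq zero_sum_quadruples_def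
      by (intro bent_majority_concat[of p k q r s]) auto
    then show "?F v \<in> {f. bent (2 * k + 2) f}"
      by (simp add: v_eq)
  qed
  ultimately have "card ?D \<le> card {f. bent (2 * k + 2) f}"
    using finite_bent by (rule card_inj_on_le)
  moreover have "card ?S = 2 ^ 2 ^ k"
    unfolding boolean_functions_def by (simp add: card_funcsetE card_F2_space)
  ultimately show ?thesis
    by (simp add: num_bent_def card_cartesian_product power_add[symmetric] mult_2 numeral_3_eq_3)
qed

section \<open>Logarithmic estimates\<close>

text \<open>The left side is one term of the exponential series, whose terms are all
  nonnegative.\<close>

lemma power_div_fact_le_exp:
  fixes x :: real
  assumes "0 \<le> x"
  shows "x ^ n / fact n \<le> exp x"
proof -
  have sums: "(\<lambda>n. x ^ n / fact n) sums exp x"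
    using exp_converges[of x] by (simp add: divide_inverse_commute)
  have "(\<Sum>i\<in>{n}. x ^ i / fact i) \<le> (\<Sum>i. x ^ i / fact i)"
    using sums_summable[OF sums] assms by (intro sum_le_suminf) simp_all
  then show ?thesis
    using sums_unique[OF sums] by simp
qed

lemma log2_fact_ge:
  "2 ^ k * (real k - log 2 (exp 1)) \<le> log 2 (fact (2 ^ k))"
proof -
  let ?M = "2 ^ k :: nat"
  \<comment> \<open>Taking both base and exponent equal to \<open>M\<close> gives the crude Stirling
    bound \<open>M! \<ge> (M / e) ^ M\<close>.\<close>
  have "real ?M ^ ?M \<le> fact ?M * exp (real ?M)"
    using power_div_fact_le_exp[of "real ?M" ?M] by (simp add: divide_le_eq mult.commute)
  then have "log 2 (real ?M ^ ?M) \<le> log 2 (fact ?M * exp (real ?M))"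
    by (subst log_le_cancel_iff) simp_all
  also have "\<dots> = log 2 (fact ?M) + real ?M * log 2 (exp 1)"
    by (simp add: log_mult log_exp)
  finally show ?thesis
    by (simp add: log_nat_power algebra_simps)
qed

text \<open>With \<open>M = 2 ^ k\<close>, four factorials give
  \<open>4 * M * (k - log 2 e)\<close>, the collision bound costs \<open>M * k\<close>, and the sign
  functions add \<open>3 * M\<close>.\<close>

lemma log2_num_bent_ge:
  "2 ^ k * (3 * real k + 3 - 4 * log 2 (exp 1)) \<le> log 2 (real (num_bent (2 * k + 2)))"
proof -
  let ?M = "2 ^ k :: nat" and ?Q = "card (zero_sum_quadruples k)"
  have "real (fact ?M ^ 4) \<le> real (?M ^ ?M * ?Q)"
    using card_zero_sum_quadruples_ge[of k] by (simp only: of_nat_le_iff)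
  then have fact_le: "(fact ?M :: real) ^ 4 \<le> real ?M ^ ?M * real ?Q"
    by simp
  \<comment> \<open>Monotonicity of \<open>log\<close> needs positive arguments; the factorial bound
    itself shows that quadruples exist.\<close>
  have "0 < (fact ?M :: real) ^ 4"
    by simp
  then have "0 < real ?M ^ ?M * real ?Q"
    using fact_le by linarith
  then have Q_pos: "0 < real ?Q"
    by (simp add: zero_less_mult_iff)
  have "log 2 ((fact ?M :: real) ^ 4) \<le> log 2 (real ?M ^ ?M * real ?Q)"
    using fact_le Q_pos by (subst log_le_cancel_iff) simp_all
  then have Q: "4 * log 2 (fact ?M) \<le> ?M * real k + log 2 (real ?Q)"
    using Q_pos by (simp add: log_mult log_nat_power)
  have "real (?Q * 2 ^ (3 * ?M)) \<le> real (num_bent (2 * k + 2))"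
    using num_bent_ge_zero_sum_quadruples[of k] by (simp only: of_nat_le_iff)
  then have bent_ge: "real ?Q * 2 ^ (3 * ?M) \<le> real (num_bent (2 * k + 2))"
    by simp
  have "0 < real ?Q * 2 ^ (3 * ?M)"
    using Q_pos by simp
  with bent_ge have "log 2 (real ?Q * 2 ^ (3 * ?M)) \<le> log 2 (real (num_bent (2 * k + 2)))"
    by (subst log_le_cancel_iff) linarith+
  then have "log 2 (real ?Q) + 3 * ?M \<le> log 2 (real (num_bent (2 * k + 2)))"
    using Q_pos by (simp add: log_mult log_nat_power)
  then show ?thesis
    using Q log2_fact_ge[of k] by (simp add: algebra_simps)
qed

theorem theorem2:
  shows "\<exists>\<epsilon> :: nat \<Rightarrow> real.
    \<epsilon> \<in> o[even_at_top](\<lambda>n. 2 powr (real n / 2)) \<and>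
    (\<forall>\<^sub>F n in even_at_top.
      log 2 (real (num_bent n)) \<ge>
        3 * real n / 4 * 2 powr (real n / 2) - 2 * log 2 (exp 1) * 2 powr (real n / 2) + \<epsilon> n)"
\<comment> \<open>The bound holds exactly for every even \<open>n \<ge> 2\<close>, so the zero error
  term serves.\<close>
proof (intro exI[of _ "\<lambda>_. 0"] conjI)
  show "(\<lambda>_. 0) \<in> o[even_at_top](\<lambda>n. 2 powr (real n / 2))"
    by simp
  have bound: "3 * real n / 4 * 2 powr (real n / 2) - 2 * log 2 (exp 1) * 2 powr (real n / 2) + 0
      \<le> log 2 (real (num_bent n))" if "2 \<le> n" "even n" for n
  proof -
    from \<open>even n\<close> obtain m where "n = 2 * m"
      by blast
    with \<open>2 \<le> n\<close> obtain k where n: "n = 2 * k + 2"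
      by (cases m) auto
    have powr_eq: "2 powr (real n / 2) = 2 * 2 ^ k"
      by (simp add: n add_divide_distrib powr_add powr_realpow)
    \<comment> \<open>With \<open>n = 2 * k + 2\<close>, the factor \<open>2 powr (n / 2)\<close> is
      twice \<open>2 ^ k\<close>, so \<open>3 * n / 4\<close> becomes \<open>3 * k + 3\<close> and
      the coefficient of \<open>log 2 (exp 1)\<close> becomes 4.\<close>
    have "3 * real n / 4 * 2 powr (real n / 2) - 2 * log 2 (exp 1) * 2 powr (real n / 2) + 0
        = 2 ^ k * (3 * real k + 3 - 4 * log 2 (exp 1))"
      unfolding powr_eq by (simp add: n field_simps del: log_exp)
    then show ?thesis
      using log2_num_bent_ge[of k] by (simp only: n)
  qed
  show "\<forall>\<^sub>F n in even_at_top. 3 * real n / 4 * 2 powr (real n / 2)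
      - 2 * log 2 (exp 1) * 2 powr (real n / 2) + 0 \<le> log 2 (real (num_bent n))"
    unfolding even_at_top_def eventually_inf_principal
    using eventually_ge_at_top[of 2] by eventually_elim (use bound in auto)
qed

end
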